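(* Let $T:\mathcal{M}_d\to\mathcal{M}_d$ be a quantum channel, i.e. a linear, completely positive, trace-preserving map on complex $d\times d$ matrices. Then the following are equivalent: (1) $T$ is unital, i.e. $T(\mathbb{1})=\mathbb{1}$; (2) $T$, regarded as a linear operator on the Hilbert–Schmidt Hilbert space (the space $\mathcal{M}_d$ with inner product $\langle A,B\rangle=\operatorname{tr}[A^\dagger B]$), is a convex combination of unitary operators on that Hilbert space, i.e. $T=\sum_\alpha p_\alpha W_\alpha$ with probabilities $p_\alpha\ge 0$, $\sum_\alpha p_\alpha=1$, and each $W_\alpha$ a unitary operator on the Hilbert–Schmidt space (equivalently a unitary matrix in $\mathcal{M}_{d^2}$); (3) $T$ is an affine combination of unitary conjugations: $T(\rho)=\sum_i\lambda_i U_i\rho U_i^\dagger$ for all $\rho$, with real numbers $\lambda_i$ satisfying $\sum_i\lambda_i=1$ and unitary matrices $U_i\in\mathcal{M}_d$. *)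

theory Defs
  imports "HOL-Analysis.Analysis"
begin

definition cscale :: "complex \<Rightarrow> complex^'n^'n \<Rightarrow> complex^'n^'n" where
  "cscale c A = (\<chi> i j. c * A $ i $ j)"

definition cadj :: "complex^'n^'n \<Rightarrow> complex^'n^'n" where
  "cadj A = (\<chi> i j. cnj (A $ j $ i))"

definition cunitary :: "complex^'n^'n \<Rightarrow> bool" where
  "cunitary U \<longleftrightarrow> U ** cadj U = mat 1 \<and> cadj U ** U = mat 1"

definition cinner :: "complex^'n \<Rightarrow> complex^'n \<Rightarrow> complex" where
  "cinner x y = (\<Sum>a\<in>UNIV. cnj (x $ a) * y $ a)"

definition clinear_map :: "(complex^'n^'n \<Rightarrow> complex^'n^'n) \<Rightarrow> bool" where
  "clinear_map T \<longleftrightarrow> (\<forall>A B. T (A + B) = T A + T B) \<and> (\<forall>c A. T (cscale c A) = cscale c (T A))"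

text \<open>Positive semidefiniteness of the (k d) x (k d) block matrix with d x d blocks X i j
  (i, j < k): the quadratic form is real and nonnegative.\<close>
definition block_psd :: "nat \<Rightarrow> (nat \<Rightarrow> nat \<Rightarrow> complex^'n^'n) \<Rightarrow> bool" where
  "block_psd k X \<longleftrightarrow> (\<forall>v :: nat \<Rightarrow> complex^'n.
     let q = (\<Sum>i<k. \<Sum>j<k. cinner (v i) (X i j *v v j)) in Im q = 0 \<and> Re q \<ge> 0)"

text \<open>T is completely positive: T \<otimes> id_k is positive for every k.\<close>
definition completely_positive :: "(complex^'n^'n \<Rightarrow> complex^'n^'n) \<Rightarrow> bool" where
  "completely_positive T \<longleftrightarrow> (\<forall>k X. block_psd k X \<longrightarrow> block_psd k (\<lambda>i j. T (X i j)))"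

definition trace_preserving :: "(complex^'n^'n \<Rightarrow> complex^'n^'n) \<Rightarrow> bool" where
  "trace_preserving T \<longleftrightarrow> (\<forall>A. trace (T A) = trace A)"

definition quantum_channel :: "(complex^'n^'n \<Rightarrow> complex^'n^'n) \<Rightarrow> bool" where
  "quantum_channel T \<longleftrightarrow> clinear_map T \<and> completely_positive T \<and> trace_preserving T"

definition unital :: "(complex^'n^'n \<Rightarrow> complex^'n^'n) \<Rightarrow> bool" where
  "unital T \<longleftrightarrow> T (mat 1) = mat 1"

definition hs_inner :: "complex^'n^'n \<Rightarrow> complex^'n^'n \<Rightarrow> complex" where
  "hs_inner A B = trace (cadj A ** B)"

definition hs_unitary :: "(complex^'n^'n \<Rightarrow> complex^'n^'n) \<Rightarrow> bool" where
  "hs_unitary W \<longleftrightarrow> clinear_map W \<and> surj W \<and> (\<forall>A B. hs_inner (W A) (W B) = hs_inner A B)"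

end

theory Submission
  imports Defs
begin

text \<open>
  A unital channel satisfies the Schwarz inequality T(A)* T(A) \<le> T(A* A); taking traces, T is a
  Hilbert--Schmidt contraction. The extreme points of the unit ball of operators are the unitaries: an extreme M
  satisfies M (1 - M* M) = 0, since M \<plusminus> M (1 - M* M) / 2 are contractions, and M is injective, since otherwise
  M \<plusminus> |w><u| are contractions for unit vectors u in the kernel of M and w in the kernel of M*.
  By Krein--Milman, every contraction is a convex combination of unitaries. Conversely, a trace-preserving T of this
  form has norm T(1) \<le> norm 1 and <1, T(1)> = <1, 1>, so T(1) = 1.

  The complex span of the unitary conjugations is an algebra. Averaging over diagonal phases puts
  |E_ij><E_ij| into it for i \<noteq> j; since the unitary conjugates of E_ij span the traceless matrices, it contains
  |A><B| for all traceless A and B. If T is unital and trace preserving, T - id is a sum of such operators.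
  As T preserves Hermitian conjugation, the coefficients may be replaced by their real parts.
\<close>

section \<open>Adjoints and the inner product on vectors\<close>

lemma matrix_mult_nth: "(A ** B) $ i $ j = (\<Sum>k\<in>UNIV. A $ i $ k * B $ k $ j)"
  by (simp add: matrix_matrix_mult_def)

lemma cadj_nth [simp]: "cadj A $ i $ j = cnj (A $ j $ i)"
  by (simp add: cadj_def)

lemma cscale_nth [simp]: "cscale c A $ i $ j = c * A $ i $ j"
  by (simp add: cscale_def)

lemma cadj_cadj [simp]: "cadj (cadj A) = A"
  by (simp add: vec_eq_iff)

lemma cadj_mult: "cadj (A ** B) = cadj B ** cadj A"
  by (simp add: vec_eq_iff matrix_mult_nth mult.commute)

lemma cadj_mat_1 [simp]: "cadj (mat 1) = mat 1"
  by (simp add: vec_eq_iff mat_def)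

lemma scaleR_eq_cscale: "r *\<^sub>R A = cscale (complex_of_real r) A"
  by (simp add: vec_eq_iff) (simp add: scaleR_conv_of_real)

lemma matrix_vector_mult_scaleR_left:
  fixes A :: "complex^'n^'m"
  shows "(r *\<^sub>R A) *v x = r *\<^sub>R (A *v x)"
  by (simp add: vec_eq_iff matrix_vector_mult_def scaleR_sum_right)

lemma matrix_vector_mult_scaleR_right:
  fixes A :: "complex^'n^'m"
  shows "A *v (r *\<^sub>R x) = r *\<^sub>R (A *v x)"
  by (simp add: vec_eq_iff matrix_vector_mult_def scaleR_sum_right)

lemma inner_eq_Re_cinner: "x \<bullet> y = Re (cinner x y)"
  by (simp add: inner_vec_def cinner_def inner_complex_def)

lemma norm_square_eq_cinner: "complex_of_real ((norm x)\<^sup>2) = cinner x x"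
proof -
  have "Im (cinner x x) = 0"
    by (simp add: cinner_def)
  then show ?thesis
    by (simp add: complex_eq_iff power2_norm_eq_inner inner_eq_Re_cinner)
qed

lemma cinner_matrix_left: "cinner (A *v x) y = cinner x (cadj A *v y)"
proof -
  have "cinner (A *v x) y = (\<Sum>i\<in>UNIV. \<Sum>j\<in>UNIV. cnj (A $ i $ j) * cnj (x $ j) * y $ i)"
    by (simp add: cinner_def matrix_vector_mult_def sum_distrib_right)
  also have "\<dots> = (\<Sum>j\<in>UNIV. \<Sum>i\<in>UNIV. cnj (A $ i $ j) * cnj (x $ j) * y $ i)"
    by (rule sum.swap)
  also have "\<dots> = cinner x (cadj A *v y)"
    by (simp add: cinner_def matrix_vector_mult_def sum_distrib_left mult_ac)
  finally show ?thesis .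
qed

lemma inner_matrix_left: "(A *v x) \<bullet> y = x \<bullet> (cadj A *v y)"
  by (simp add: inner_eq_Re_cinner cinner_matrix_left)

section \<open>Contractive matrices\<close>

definition contractions :: "(complex^'m^'m) set" where
  "contractions = {M. \<forall>x. norm (M *v x) \<le> norm x}"

lemma convex_contractions: "convex contractions"
proof (rule convexI)
  fix A B :: "complex^'m^'m" and u v :: real
  assume A: "A \<in> contractions" and B: "B \<in> contractions" and uv: "0 \<le> u" "0 \<le> v" "u + v = 1"
  have "norm ((u *\<^sub>R A + v *\<^sub>R B) *v x) \<le> norm x" for x
  proof -
    have "norm ((u *\<^sub>R A + v *\<^sub>R B) *v x) \<le> u * norm (A *v x) + v * norm (B *v x)"
      using uv norm_triangle_ineq[of "u *\<^sub>R (A *v x)" "v *\<^sub>R (B *v x)"]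
      by (simp add: matrix_vector_mult_add_rdistrib matrix_vector_mult_scaleR_left)
    also have "\<dots> \<le> u * norm x + v * norm x"
      using A B uv by (intro add_mono mult_left_mono) (auto simp: contractions_def)
    also have "\<dots> = norm x"
      using uv by (simp flip: distrib_right)
    finally show ?thesis .
  qed
  then show "u *\<^sub>R A + v *\<^sub>R B \<in> contractions"
    by (simp add: contractions_def)
qed

lemma matrix_vector_axis_nth: "(A *v axis j c) $ i = A $ i $ j * c"
  for A :: "'a::comm_semiring_1^'n^'m"
  by (simp add: matrix_vector_mult_def axis_def if_distrib[of "(*) _"] cong: if_cong)

text \<open>The set is an intersection of closed conditions, one for each vector. It is bounded
  because applying a contraction to a basis vector shows that every entry has modulus at most
  1.\<close>

lemma compact_contractions: "compact (contractions :: (complex^'m^'m) set)"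
proof -
  have "closed {M :: complex^'m^'m. norm (M *v x) \<le> norm x}" for x
    unfolding matrix_vector_mult_def
    by (intro closed_Collect_le continuous_intros)
  then have "closed (\<Inter>x. {M :: complex^'m^'m. norm (M *v x) \<le> norm x})"
    by blast
  moreover have "(\<Inter>x. {M :: complex^'m^'m. norm (M *v x) \<le> norm x}) = contractions"
    by (auto simp: contractions_def)
  moreover have "norm M \<le> (\<Sum>i\<in>(UNIV::'m set). \<Sum>j\<in>(UNIV::'m set). 1)"
    if M: "M \<in> contractions" for M :: "complex^'m^'m"
  proof -
    have "norm (M $ i $ j) \<le> 1" for i j
    proof -
      have "norm (M $ i $ j) = norm ((M *v axis j 1) $ i)"
        by (simp add: matrix_vector_axis_nth)
      also have "\<dots> \<le> norm (M *v axis j 1)"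
        by (rule Finite_Cartesian_Product.norm_nth_le)
      also have "\<dots> \<le> norm (axis j (1::complex) :: complex^'m)"
        using M unfolding contractions_def by blast
      also have "\<dots> = 1"
        by (simp add: norm_axis_1)
      finally show ?thesis .
    qed
    then have "(\<Sum>i\<in>UNIV. \<Sum>j\<in>UNIV. norm (M $ i $ j)) \<le> (\<Sum>i\<in>(UNIV::'m set). \<Sum>j\<in>(UNIV::'m set). 1)"
      by (intro sum_mono)
    moreover have "norm M \<le> (\<Sum>i\<in>UNIV. norm (M $ i))"
      by (simp add: norm_vec_def L2_set_le_sum)
    moreover have "(\<Sum>i\<in>UNIV. norm (M $ i)) \<le> (\<Sum>i\<in>UNIV. \<Sum>j\<in>UNIV. norm (M $ i $ j))"
      by (intro sum_mono) (simp add: norm_vec_def L2_set_le_sum)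
    ultimately show ?thesis
      by linarith
  qed
  then have "bounded (contractions :: (complex^'m^'m) set)"
    by (meson boundedI)
  ultimately show ?thesis
    by (simp add: compact_eq_bounded_closed)
qed

text \<open>\<open>M\<close> is the midpoint of \<open>M + N\<close> and \<open>M - N\<close>, so a
  nonzero \<open>N\<close> would put it inside an open segment of \<open>S\<close>.\<close>

lemma extreme_point_perturbation_zero:
  assumes "M extreme_point_of S" "M + N \<in> S" "M - N \<in> S"
  shows "N = 0"
proof (rule ccontr)
  assume "N \<noteq> 0"
  then have "M + N \<noteq> M - N"
    using scaleR_eq_0_iff[of 2 N] by (auto simp: algebra_simps scaleR_2)
  moreover have "M = midpoint (M + N) (M - N)"
    by (simp add: midpoint_def flip: scaleR_2)
  ultimately have "M \<in> open_segment (M + N) (M - N)"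
    by (metis midpoint_in_open_segment)
  then show False
    using assms by (auto simp: extreme_point_of_def)
qed

text \<open>In terms of singular values the perturbation moves s to s (3 - s^2) / 2 or s (1 + s^2) /
  2, and both stay in [0, 1]. The proof checks this with quadratic forms instead of a singular value
  decomposition.\<close>

lemma extreme_contraction_partial_isometry:
  assumes M: "M extreme_point_of contractions"
  shows "M ** (mat 1 - cadj M ** M) = 0"
proof -
  define R where "R = mat 1 - cadj M ** M"
  have Mc: "norm (M *v x) \<le> norm x" for x
    using M by (simp add: extreme_point_of_def contractions_def)
  have Mz: "(norm (M *v z))\<^sup>2 = (norm z)\<^sup>2 - z \<bullet> (R *v z)" for z
    by (simp add: R_def power2_norm_eq_inner inner_matrix_left matrix_vector_mul_assoc inner_diff_right
        matrix_vector_mult_diff_rdistrib)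
  have Rsym: "(R *v x) \<bullet> y = x \<bullet> (R *v y)" for x y
  proof -
    have "cadj R = R"
      by (simp add: R_def vec_eq_iff mat_def matrix_mult_nth mult.commute)
    then show ?thesis
      by (simp add: inner_matrix_left)
  qed
  have plus: "M + (1/2) *\<^sub>R (M ** R) \<in> contractions"
  proof -
    have "norm ((M + (1/2) *\<^sub>R (M ** R)) *v x) \<le> norm x" for x
    proof -
      define y where "y = R *v x"
      define z where "z = x + (1/2) *\<^sub>R y"
      have eq: "(M + (1/2) *\<^sub>R (M ** R)) *v x = M *v z"
        by (simp add: z_def y_def matrix_vector_mult_add_rdistrib matrix_vector_mult_scaleR_left
            matrix_vector_mult_scaleR_right matrix_vector_right_distrib matrix_vector_mul_assoc)
      \<comment> \<open>Subtracting this from |z|^2 cancels the mixed term: |M z|^2 = |x|^2 - 3/4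
        |y|^2 - 1/4 <y, R y>, and the last form is nonnegative because \<open>M\<close> is a
        contraction.\<close>
      have "z \<bullet> (R *v z) = x \<bullet> y + y \<bullet> y + (1/4) * (y \<bullet> (R *v y))"
        using Rsym[of x y]
        by (simp add: z_def matrix_vector_right_distrib matrix_vector_mult_scaleR_right inner_add_left
            inner_add_right inner_commute field_simps flip: y_def)
      moreover have "(norm z)\<^sup>2 = x \<bullet> x + x \<bullet> y + (1/4) * (y \<bullet> y)"
        by (simp add: z_def power2_norm_eq_inner inner_add_left inner_add_right inner_commute)
      moreover have "0 \<le> y \<bullet> (R *v y)"
        using Mz[of y] Mc[of y] by (smt (verit) norm_ge_zero power_mono)
      ultimately have "(norm (M *v z))\<^sup>2 \<le> (norm x)\<^sup>2"
        using Mz[of z] by (simp add: power2_norm_eq_inner) (smt (verit) inner_ge_zero)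
      then show ?thesis
        by (simp add: eq)
    qed
    then show ?thesis
      by (simp add: contractions_def)
  qed
  have minus: "M - (1/2) *\<^sub>R (M ** R) \<in> contractions"
  proof -
    have "norm ((M - (1/2) *\<^sub>R (M ** R)) *v x) \<le> norm x" for x
    proof -
      define z where "z = x - (1/2) *\<^sub>R (R *v x)"
      have eq: "(M - (1/2) *\<^sub>R (M ** R)) *v x = M *v z"
        by (simp add: z_def matrix_vector_mult_diff_rdistrib matrix_vector_mult_scaleR_left
            matrix_vector_mult_scaleR_right matrix_vector_mult_diff_distrib matrix_vector_mul_assoc)
      have "norm z \<le> norm x"
      proof -
        \<comment> \<open>The minus sign makes z the average of x and M* M x, so it suffices that
          the adjoint of a contraction is a contraction, by Cauchy-Schwarz.\<close>
        have Mstar: "norm (cadj M *v w) \<le> norm w" for w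
        proof -
          have "(norm (cadj M *v w))\<^sup>2 = w \<bullet> (M *v (cadj M *v w))"
            by (simp add: power2_norm_eq_inner inner_matrix_left)
          also have "\<dots> \<le> norm w * norm (M *v (cadj M *v w))"
            by (rule norm_cauchy_schwarz)
          also have "\<dots> \<le> norm w * norm (cadj M *v w)"
            using Mc by (intro mult_left_mono) auto
          finally show ?thesis
            by (cases "cadj M *v w = 0") (auto simp: power2_eq_square)
        qed
        have "2 *\<^sub>R z = x + cadj M *v (M *v x)"
          by (simp add: z_def R_def matrix_vector_mult_diff_rdistrib matrix_vector_mul_assoc
              scaleR_2 algebra_simps)
        then have "2 * norm z = norm (x + cadj M *v (M *v x))"
          by (metis abs_numeral norm_scaleR)
        also have "\<dots> \<le> norm x + norm x"
          using Mstar[of "M *v x"] Mc[of x] norm_triangle_ineq[of x "cadj M *v (M *v x)"] by linarith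
        finally show ?thesis by simp
      qed
      then show ?thesis
        using Mc[of z] by (simp add: eq)
    qed
    then show ?thesis
      by (simp add: contractions_def)
  qed
  show ?thesis
    using extreme_point_perturbation_zero[OF M plus minus] by (simp add: R_def)
qed

text \<open>A singular square matrix and its adjoint both have a nonzero kernel vector. The operator
  |w><u| built from them acts where \<open>M\<close> vanishes and maps into the orthogonal
  complement of the range of \<open>M\<close>, so adding it with either sign keeps a
  contraction.\<close>

lemma extreme_contraction_invertible:
  assumes M: "M extreme_point_of contractions"
  shows "invertible M"
proof (rule ccontr)
  assume ninv: "\<not> invertible M"
  have Mc: "norm (M *v x) \<le> norm x" for x
    using M by (simp add: extreme_point_of_def contractions_def)
  have "\<not> (\<exists>B. B ** M = mat 1)"
    using ninv by (metis invertible_left_inverse)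
  then obtain u0 where u0: "M *v u0 = 0" "u0 \<noteq> 0"
    by (auto simp: matrix_left_invertible_ker)
  have "\<not> (\<exists>B. B ** cadj M = mat 1)"
    using ninv by (metis invertible_right_inverse cadj_cadj cadj_mat_1 cadj_mult)
  then obtain w0 where w0: "cadj M *v w0 = 0" "w0 \<noteq> 0"
    by (auto simp: matrix_left_invertible_ker)
  define u where "u = (1 / norm u0) *\<^sub>R u0"
  define w where "w = (1 / norm w0) *\<^sub>R w0"
  have u: "M *v u = 0" "norm u = 1" and w: "cadj M *v w = 0" "norm w = 1"
    using u0 w0 by (simp_all add: u_def w_def matrix_vector_mult_scaleR_right)
  define N where "N = (\<chi> i j. w $ i * cnj (u $ j))"
  have Nx: "N *v x = cinner u x *s w" for x
    by (simp add: N_def vec_eq_iff matrix_vector_mult_def cinner_def sum_distrib_left sum_distrib_right mult_ac)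
  \<comment> \<open>The scalar e is 1 or -1, treating both signs at once. Removing the component c u
    from x leaves M x unchanged and lowers the squared norm by |c|^2; the perturbation, orthogonal
    to M x, adds exactly |c|^2 back.\<close>
  have bound: "norm (M *v x + e *\<^sub>R (N *v x)) \<le> norm x" if e: "e * e = 1" for x and e :: real
  proof -
    define c where "c = cinner u x"
    have norm_cs: "(norm (c *s v))\<^sup>2 = (cmod c)\<^sup>2 * (norm v)\<^sup>2" for v :: "complex^'a"
      by (simp add: norm_vec_def L2_set_def sum_nonneg norm_mult power_mult_distrib sum_distrib_left)
    have orth: "(M *v x) \<bullet> (c *s w) = 0"
      by (simp add: inner_matrix_left vector_scalar_commute w)
    have "M *v (x - c *s u) = M *v x"
      by (simp add: matrix_vector_mult_diff_distrib vector_scalar_commute u)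
    then have "(norm (M *v x))\<^sup>2 \<le> (norm (x - c *s u))\<^sup>2"
      by (metis Mc norm_ge_zero power_mono)
    also have "\<dots> = (norm x)\<^sup>2 - 2 * (x \<bullet> (c *s u)) + (cmod c)\<^sup>2"
      using norm_cs[of u] u by (simp add: power2_norm_eq_inner inner_diff_left inner_diff_right inner_commute)
    also have "x \<bullet> (c *s u) = (cmod c)\<^sup>2"
    proof -
      have "cinner (c *s u) x = cnj c * c"
        by (simp add: cinner_def c_def sum_distrib_left mult_ac)
      then show ?thesis
        by (subst inner_commute) (simp add: inner_eq_Re_cinner cmod_power2 flip: power2_eq_square)
    qed
    finally have "(norm (M *v x))\<^sup>2 + (cmod c)\<^sup>2 \<le> (norm x)\<^sup>2"
      by simp
    moreover have "(norm (M *v x + e *\<^sub>R (N *v x)))\<^sup>2 = (norm (M *v x))\<^sup>2 + (cmod c)\<^sup>2"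
      using norm_cs[of w] w orth e
      by (simp add: Nx power2_norm_eq_inner inner_add_left inner_add_right inner_commute flip: c_def mult.assoc)
    ultimately show ?thesis
      by (metis norm_ge_zero power2_le_imp_le)
  qed
  have "M + N \<in> contractions" "M - N \<in> contractions"
    using bound[of 1] bound[of "-1"]
    by (auto simp: contractions_def matrix_vector_mult_add_rdistrib matrix_vector_mult_diff_rdistrib)
  then have "N = 0"
    by (rule extreme_point_perturbation_zero[OF M])
  then have "cinner u u *s w = 0"
    using Nx[of u] by simp
  then show False
    using u w norm_square_eq_cinner[of u] by auto
qed

lemma extreme_contraction_unitary:
  assumes M: "M extreme_point_of contractions"
  shows "cunitary M"
proof -
  obtain B where B: "B ** M = mat 1"
    using extreme_contraction_invertible[OF M] by (auto simp: invertible_def)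
  have "mat 1 - cadj M ** M = B ** (M ** (mat 1 - cadj M ** M))"
    by (simp add: matrix_mul_assoc B)
  also have "\<dots> = 0"
    unfolding extreme_contraction_partial_isometry[OF M] by (simp add: matrix_mult_nth vec_eq_iff)
  finally have "cadj M ** M = mat 1"
    by simp
  then show ?thesis
    by (simp add: cunitary_def matrix_left_right_inverse)
qed

proposition contraction_convex_combination_unitaries:
  fixes M :: "complex^'m^'m"
  assumes "\<And>x. norm (M *v x) \<le> norm x"
  obtains k :: nat and p :: "nat \<Rightarrow> real" and V where
    "\<And>i. i < k \<Longrightarrow> 0 \<le> p i \<and> cunitary (V i)" "(\<Sum>i<k. p i) = 1" "M = (\<Sum>i<k. p i *\<^sub>R V i)"
proof -
  have "M \<in> contractions"
    using assms by (simp add: contractions_def)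
  then have "M \<in> convex hull {A. A extreme_point_of contractions}"
    using Krein_Milman_Minkowski[OF compact_contractions convex_contractions] by blast
  then obtain k u x where *: "\<forall>i\<in>{1::nat..k}. 0 \<le> u i \<and> x i extreme_point_of contractions"
      "sum u {1..k} = 1" "(\<Sum>i = 1..k. u i *\<^sub>R x i) = M"
    by (auto simp: convex_hull_indexed)
  show ?thesis
  proof
    \<comment> \<open>\<open>convex_hull_indexed\<close> numbers the points from 1 to k; the
      conclusion numbers them from 0.\<close>
    show "0 \<le> u (Suc i) \<and> cunitary (x (Suc i))" if "i < k" for i
      using *(1)[rule_format, of "Suc i"] that extreme_contraction_unitary by auto
    show "(\<Sum>i<k. u (Suc i)) = 1" "M = (\<Sum>i<k. u (Suc i) *\<^sub>R x (Suc i))"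
      using * by (simp_all add: sum.atLeast1_atMost_eq)
  qed
qed

section \<open>Hilbert--Schmidt geometry\<close>

text \<open>Indexing coordinates by pairs turns a linear map on matrices into a square matrix over
  \<open>'n \<times> 'n\<close>, so that the results on contractive matrices apply to it.\<close>

definition vectorize :: "complex^'n^'n \<Rightarrow> complex^('n \<times> 'n)" where
  "vectorize X = (\<chi> q. X $ fst q $ snd q)"

definition unvectorize :: "complex^('n \<times> 'n) \<Rightarrow> complex^'n^'n" where
  "unvectorize x = (\<chi> i j. x $ (i, j))"

lemma vectorize_nth [simp]: "vectorize X $ (i, j) = X $ i $ j"
  by (simp add: vectorize_def)

lemma unvectorize_nth [simp]: "unvectorize x $ i $ j = x $ (i, j)"
  by (simp add: unvectorize_def)

lemma unvectorize_vectorize [simp]: "unvectorize (vectorize X) = X"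
  by (simp add: vec_eq_iff)

lemma vectorize_unvectorize [simp]: "vectorize (unvectorize x) = x"
  by (simp add: vec_eq_iff)

lemma hs_inner_eq_sum: "hs_inner A B = (\<Sum>i\<in>UNIV. \<Sum>j\<in>UNIV. cnj (A $ i $ j) * B $ i $ j)"
  unfolding hs_inner_def trace_def matrix_mult_nth cadj_nth by (rule sum.swap)

lemma hs_inner_eq_cinner: "hs_inner A B = cinner (vectorize A) (vectorize B)"
  by (simp add: hs_inner_eq_sum cinner_def sum.cartesian_product vectorize_def split_def flip: UNIV_Times_UNIV)

text \<open>This identifies the norm of the type \<open>complex^'n^'n\<close> with the
  Hilbert-Schmidt norm.\<close>

lemma Re_hs_inner: "Re (hs_inner A B) = A \<bullet> B"
  by (simp add: hs_inner_eq_sum inner_vec_def inner_complex_def)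

lemma norm_vectorize: "norm (vectorize A) = norm A"
  by (simp add: norm_eq_sqrt_inner inner_eq_Re_cinner Re_hs_inner flip: hs_inner_eq_cinner)

lemma matrix_mult_cscale_left: "cscale c A ** B = cscale c (A ** B)"
  by (simp add: vec_eq_iff matrix_mult_nth sum_distrib_left mult_ac)

lemma matrix_mult_cscale_right: "A ** cscale c B = cscale c (A ** B)"
  by (simp add: vec_eq_iff matrix_mult_nth sum_distrib_left mult_ac)

lemma trace_mult_commute: "trace (A ** B) = trace (B ** A)"
  for A B :: "complex^'n^'n"
  unfolding trace_def matrix_mult_nth by (subst sum.swap) (simp add: mult.commute)

text \<open>By cyclicity of the trace, the Hilbert-Schmidt adjoint of conjugation by U is
  conjugation by its adjoint. It serves to move conjugations onto the left argument.\<close>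

lemma hs_inner_conjugate: "hs_inner B (cadj U ** X ** U) = hs_inner (U ** B ** cadj U) X"
  unfolding hs_inner_def
  by (metis (no_types) cadj_cadj cadj_mult matrix_mul_assoc trace_mult_commute)

definition matrix_unit :: "'n \<Rightarrow> 'n \<Rightarrow> complex^'n^'n" where
  "matrix_unit i j = (\<chi> a b. if a = i \<and> b = j then 1 else 0)"

lemma matrix_unit_nth: "matrix_unit i j $ a $ b = (if a = i \<and> b = j then 1 else 0)"
  by (simp add: matrix_unit_def)

lemma sum_delta_pair:
  fixes f :: "'a::finite \<Rightarrow> 'a \<Rightarrow> complex"
  shows "(\<Sum>i\<in>UNIV. \<Sum>j\<in>UNIV. f i j * (if a = i \<and> b = j then 1 else 0)) = f a b"
proof -
  have "(\<Sum>j\<in>UNIV. f i j * (if a = i \<and> b = j then 1 else 0)) = (if a = i then f a b else 0)" for i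
    by (cases "a = i") (simp_all add: if_distrib[of "(*) _"] cong: if_cong)
  then show ?thesis by simp
qed

lemma matrix_unit_expansion: "A = (\<Sum>i\<in>UNIV. \<Sum>j\<in>UNIV. cscale (A $ i $ j) (matrix_unit i j))"
  by (simp add: vec_eq_iff matrix_unit_nth sum_delta_pair)

lemma hs_inner_matrix_unit: "hs_inner (matrix_unit i j) X = X $ i $ j"
  using sum_delta_pair[of "\<lambda>a b. X $ a $ b" i j]
  by (simp add: hs_inner_eq_sum matrix_unit_nth eq_commute mult.commute if_distrib[of cnj] cong: if_cong)

lemma clinear_map_add: "clinear_map T \<Longrightarrow> T (A + B) = T A + T B"
  and clinear_map_cscale: "clinear_map T \<Longrightarrow> T (cscale c A) = cscale c (T A)"
  by (simp_all add: clinear_map_def)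

lemma clinear_map_zero: "clinear_map T \<Longrightarrow> T 0 = 0"
  by (metis add_cancel_right_right clinear_map_add)

lemma clinear_map_sum: "clinear_map T \<Longrightarrow> T (\<Sum>i\<in>I. F i) = (\<Sum>i\<in>I. T (F i))"
  by (induction I rule: infinite_finite_induct) (simp_all add: clinear_map_zero clinear_map_add)

lemma clinear_map_matrix:
  fixes T :: "complex^'n^'n \<Rightarrow> complex^'n^'n"
  assumes "clinear_map T"
  obtains M where "\<And>X. T X = unvectorize (M *v vectorize X)"
proof
  fix X
  have "T X = (\<Sum>i\<in>UNIV. \<Sum>j\<in>UNIV. cscale (X $ i $ j) (T (matrix_unit i j)))"
    using assms by (subst matrix_unit_expansion[of X]) (simp add: clinear_map_sum clinear_map_cscale)
  then show "T X = unvectorize ((\<chi> p q. T (matrix_unit (fst q) (snd q)) $ fst p $ snd p) *v vectorize X)"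
    by (simp add: vec_eq_iff matrix_vector_mult_def sum.cartesian_product vectorize_def split_def mult.commute
        flip: UNIV_Times_UNIV)
qed

lemma cunitary_hs_unitary:
  assumes "cunitary V"
  shows "hs_unitary (\<lambda>X. unvectorize (V *v vectorize X))"
  unfolding hs_unitary_def
proof (intro conjI allI)
  show "clinear_map (\<lambda>X. unvectorize (V *v vectorize X))"
    by (simp add: clinear_map_def vec_eq_iff matrix_vector_mult_def sum.distrib sum_distrib_left
        algebra_simps vectorize_def)
  have "unvectorize (V *v vectorize (unvectorize (cadj V *v vectorize Y))) = Y" for Y
    using assms by (simp add: matrix_vector_mul_assoc cunitary_def)
  then show "surj (\<lambda>X. unvectorize (V *v vectorize X))"
    by (rule surjI)
  show "hs_inner (unvectorize (V *v vectorize A)) (unvectorize (V *v vectorize B)) = hs_inner A B" for A B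
    using assms by (simp add: hs_inner_eq_cinner cinner_matrix_left matrix_vector_mul_assoc cunitary_def)
qed

lemma hs_contraction_convex_combination:
  fixes T :: "complex^'n^'n \<Rightarrow> complex^'n^'n"
  assumes lin: "clinear_map T" and contr: "\<And>X. norm (T X) \<le> norm X"
  obtains k :: nat and p :: "nat \<Rightarrow> real" and W where
    "\<And>i. i < k \<Longrightarrow> 0 \<le> p i \<and> hs_unitary (W i)" "(\<Sum>i<k. p i) = 1"
    "\<And>A. T A = (\<Sum>i<k. cscale (complex_of_real (p i)) (W i A))"
proof -
  obtain M where M: "\<And>X. T X = unvectorize (M *v vectorize X)"
    using clinear_map_matrix[OF lin] by blast
  have "norm (M *v x) \<le> norm x" for x
    using contr[of "unvectorize x"] by (simp add: M flip: norm_vectorize)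
  then obtain k p V where V: "\<And>i. i < k \<Longrightarrow> 0 \<le> p i \<and> cunitary (V i)" "(\<Sum>i<k. p i) = 1"
      "M = (\<Sum>i<(k::nat). p i *\<^sub>R V i)"
    by (rule contraction_convex_combination_unitaries) blast
  have "T A = (\<Sum>i<k. cscale (complex_of_real (p i)) (unvectorize (V i *v vectorize A)))" for A
  proof -
    have "M *v x = (\<Sum>i<k. p i *\<^sub>R (V i *v x))" for x
      unfolding V(3) by (induction k) (simp_all add: matrix_vector_mult_add_rdistrib matrix_vector_mult_scaleR_left)
    then show ?thesis
      by (simp add: M vec_eq_iff) (simp add: scaleR_conv_of_real)
  qed
  then show ?thesis
    using V cunitary_hs_unitary by (intro that[of k p "\<lambda>i X. unvectorize (V i *v vectorize X)"]) auto
qed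

section \<open>Unital channels\<close>

text \<open>The block matrix is the Gram matrix of the block row (1, A): its quadratic form at (x,
  y) is |x + A y|^2.\<close>

lemma block_psd_schwarz:
  "block_psd 2 (\<lambda>i j. if i = 0 then if j = 0 then mat 1 else A
                      else if j = 0 then cadj A else cadj A ** A)"
proof -
  have "cinner x x + cinner x (A *v y) + (cinner y (cadj A *v x) + cinner y ((cadj A ** A) *v y))
      = complex_of_real ((norm (x + A *v y))\<^sup>2)" for x y
  proof -
    have "cinner (u + v) (u + v) = cinner u u + cinner u v + (cinner v u + cinner v v)" for u v :: "complex^'a"
      by (simp add: cinner_def distrib_left distrib_right sum.distrib)
    then show ?thesis
      by (simp only: norm_square_eq_cinner) (simp add: cinner_matrix_left matrix_vector_mul_assoc)
  qed
  then show ?thesis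
    by (simp add: block_psd_def Let_def numeral_2_eq_2)
qed

text \<open>Complete positivity is used at k = 2; unitality keeps the corner block equal to 1. The
  vanishing imaginary part yields preservation of adjoints, the sign of the real part yields the
  Schwarz inequality.\<close>

lemma channel_schwarz_form:
  assumes "completely_positive T" "unital T"
  shows "Im (cinner x x + cinner x (T A *v y) + (cinner y (T (cadj A) *v x) + cinner y (T (cadj A ** A) *v y))) = 0"
    and "0 \<le> Re (cinner x x + cinner x (T A *v y) + (cinner y (T (cadj A) *v x) + cinner y (T (cadj A ** A) *v y)))"
proof -
  define v where "v i = (if i = (0::nat) then x else y)" for i
  have "block_psd 2 (\<lambda>i j. T (if i = 0 then if j = 0 then mat 1 else A
                      else if j = 0 then cadj A else cadj A ** A))"
    using assms(1) block_psd_schwarz[of A] unfolding completely_positive_def by blast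
  from this[unfolded block_psd_def Let_def, rule_format, of v]
  show "Im (cinner x x + cinner x (T A *v y) + (cinner y (T (cadj A) *v x) + cinner y (T (cadj A ** A) *v y))) = 0"
    and "0 \<le> Re (cinner x x + cinner x (T A *v y) + (cinner y (T (cadj A) *v x) + cinner y (T (cadj A ** A) *v y)))"
    using assms(2) by (simp_all add: numeral_2_eq_2 v_def unital_def)
qed

lemma cinner_axis: "cinner (axis a c) y = cnj c * y $ a"
  by (simp add: cinner_def axis_def if_distrib[of cnj] if_distrib[of "\<lambda>z. z * _"] cong: if_cong)

lemma unital_cp_hermitian_preserving:
  assumes T: "completely_positive T" "unital T"
  shows "T (cadj A) = cadj (T A)"
proof -
  have *: "Im (cinner x (T A *v y) + cinner y (T (cadj A) *v x)) = 0" for x y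
  proof -
    have "Im (cinner x x) = 0"
      by (metis Im_complex_of_real norm_square_eq_cinner)
    moreover have "Im (cinner y (T (cadj A ** A) *v y)) = 0"
      using channel_schwarz_form(1)[OF T, of 0 A y] by (simp add: cinner_def)
    ultimately show ?thesis
      using channel_schwarz_form(1)[OF T, of x A y] by simp
  qed
  \<comment> \<open>The choice x = e_a compares the imaginary parts of the two entries, x = i e_a
    their real parts.\<close>
  have "T (cadj A) $ b $ a = cnj (T A $ a $ b)" for a b
    using *[of "axis a 1" "axis b 1"] *[of "axis a \<i>" "axis b 1"]
    by (simp add: cinner_axis matrix_vector_axis_nth complex_eq_iff)
  then show ?thesis
    by (simp add: vec_eq_iff)
qed

lemma unital_channel_contraction:
  assumes T: "quantum_channel T" "unital T"
  shows "norm (T A) \<le> norm A"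
proof -
  have cp: "completely_positive T" and tp: "\<And>A. trace (T A) = trace A"
    using T by (auto simp: quantum_channel_def trace_preserving_def)
  have "Re ((cadj (T A) ** T A) $ a $ a) \<le> Re (T (cadj A ** A) $ a $ a)" for a
  proof -
    define y :: "complex^'a" where "y = axis a 1"
    \<comment> \<open>This x minimises the form for fixed y: the first two terms cancel, and what
      remains is the Schwarz inequality tested at y.\<close>
    define x where "x = - (T A *v y)"
    have "cinner x x = - cinner x (T A *v y)"
      by (simp add: x_def cinner_def sum_negf)
    moreover have "T (cadj A) *v x = - ((cadj (T A) ** T A) *v y)"
      by (simp add: x_def unital_cp_hermitian_preserving[OF cp T(2)] flip: matrix_vector_mul_assoc)
        (simp add: vec_eq_iff matrix_vector_mult_def sum_negf)
    ultimately show ?thesis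
      using channel_schwarz_form(2)[OF cp T(2), of x A y]
      by (simp add: y_def cinner_axis matrix_vector_axis_nth)
  qed
  then have "Re (hs_inner (T A) (T A)) \<le> Re (trace (T (cadj A ** A)))"
    by (simp add: hs_inner_def trace_def sum_mono)
  also have "\<dots> = Re (hs_inner A A)"
    by (simp add: tp hs_inner_def)
  finally show ?thesis
    by (simp add: Re_hs_inner norm_le)
qed

lemma unital_if_convex_combination:
  assumes tp: "trace_preserving T"
    and W: "\<And>i. i < m \<Longrightarrow> 0 \<le> p i \<and> hs_unitary (W i)" and p: "(\<Sum>i<m. p i) = 1"
    and T: "\<And>A. T A = (\<Sum>i<m. cscale (complex_of_real (p i)) (W i A))"
  shows "unital T"
proof -
  define I :: "complex^'a^'a" where "I = mat 1"
  have "norm (T I) \<le> (\<Sum>i<m. p i * norm I)"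
    unfolding T scaleR_eq_cscale[symmetric]
  proof (rule order_trans[OF norm_sum sum_mono])
    fix i assume "i \<in> {..<m}"
    then have i: "0 \<le> p i" "hs_unitary (W i)"
      using W by auto
    then have "norm (W i I) = norm I"
      by (simp add: hs_unitary_def norm_eq_sqrt_inner flip: Re_hs_inner)
    then show "norm (p i *\<^sub>R W i I) \<le> p i * norm I"
      using i by simp
  qed
  then have "norm (T I) \<le> norm I"
    using p by (simp flip: sum_distrib_right)
  then have "T I \<bullet> T I \<le> I \<bullet> I"
    by (simp add: norm_le)
  moreover have "I \<bullet> T I = I \<bullet> I"
    using tp by (simp add: I_def hs_inner_def trace_preserving_def flip: Re_hs_inner)
  \<comment> \<open>The square expands to |T I|^2 - 2 <I, T I> + |I|^2, the equality case of
    Cauchy-Schwarz.\<close>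
  ultimately have "(norm (T I - I))\<^sup>2 \<le> 0"
    by (simp add: power2_norm_eq_inner inner_diff_left inner_diff_right inner_commute)
  then show ?thesis
    by (simp add: unital_def I_def)
qed

section \<open>The span of unitary conjugations\<close>

text \<open>Complex coefficients are allowed here, since the phase averages need them; real ones are
  recovered at the end. The inductive form turns each closure property into an induction over the
  three rules.\<close>

inductive conj_span :: "(complex^'n^'n \<Rightarrow> complex^'n^'n) \<Rightarrow> bool" where
  conj: "cunitary U \<Longrightarrow> conj_span (\<lambda>X. U ** X ** cadj U)"
| add: "conj_span S \<Longrightarrow> conj_span T \<Longrightarrow> conj_span (\<lambda>X. S X + T X)"
| scale: "conj_span S \<Longrightarrow> conj_span (\<lambda>X. cscale c (S X))"

lemma cscale_zero_left [simp]: "cscale 0 A = 0"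
  and cscale_zero_right [simp]: "cscale c 0 = 0"
  and cscale_one [simp]: "cscale 1 A = A"
  and cscale_cscale [simp]: "cscale c (cscale d A) = cscale (c * d) A"
  and cscale_add_left: "cscale (c + d) A = cscale c A + cscale d A"
  and cscale_add_right: "cscale c (A + B) = cscale c A + cscale c B"
  by (simp_all add: vec_eq_iff algebra_simps)

lemma matrix_mult_add_left: "(A + B) ** C = A ** C + B ** C"
  by (simp add: vec_eq_iff matrix_mult_nth distrib_right sum.distrib)

lemma cunitary_mat_1: "cunitary (mat 1)"
  by (simp add: cunitary_def)

lemma cunitary_cadj: "cunitary U \<Longrightarrow> cunitary (cadj U)"
  by (simp add: cunitary_def)

lemma cunitary_mult: "cunitary U \<Longrightarrow> cunitary V \<Longrightarrow> cunitary (U ** V)"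
  unfolding cunitary_def cadj_mult
  by (metis matrix_mul_assoc matrix_mul_lid)

lemma conj_span_id: "conj_span (\<lambda>X. X)"
  using conj_span.conj[OF cunitary_mat_1] by simp

lemma conj_span_zero: "conj_span (\<lambda>X. 0)"
  using conj_span.scale[OF conj_span_id, of 0] by simp

lemma conj_span_sum: "(\<And>i. i \<in> I \<Longrightarrow> conj_span (F i)) \<Longrightarrow> conj_span (\<lambda>X. \<Sum>i\<in>I. F i X)"
  by (induction I rule: infinite_finite_induct) (simp_all add: conj_span_zero conj_span.add)

text \<open>Conjugations compose to the conjugation by the product, and composition is bilinear on
  the span: hence an induction on S with an inner induction on T.\<close>

lemma conj_span_comp:
  assumes "conj_span S" "conj_span T"
  shows "conj_span (\<lambda>X. S (T X))"
  using assms(1)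
proof (induction rule: conj_span.induct)
  case (conj U)
  have "conj_span (\<lambda>X. U ** T X ** cadj U)"
    using assms(2)
  proof (induction rule: conj_span.induct)
    case (conj V)
    show ?case
      using conj_span.conj[OF cunitary_mult[OF \<open>cunitary U\<close> conj]]
      by (simp add: cadj_mult matrix_mul_assoc)
  next
    case (add S T)
    then show ?case
      using conj_span.add by (fastforce simp: matrix_add_ldistrib matrix_mult_add_left)
  next
    case (scale S c)
    then show ?case
      using conj_span.scale by (fastforce simp: matrix_mult_cscale_left matrix_mult_cscale_right)
  qed
  then show ?case .
qed (auto intro: conj_span.add conj_span.scale)

text \<open>The induction carries lists of weighted unitaries, for which sums are concatenations and
  scaling acts on the weights; positions in the list become indices at the end.\<close>

lemma conj_span_finite_combination:
  assumes "conj_span T"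
  obtains m :: nat and c U where "\<And>i. i < m \<Longrightarrow> cunitary (U i)"
    "\<And>X. T X = (\<Sum>i<m. cscale (c i) (U i ** X ** cadj (U i)))"
proof -
  have "\<exists>xs. (\<forall>(c, U) \<in> set xs. cunitary U) \<and> (\<forall>X. T X = (\<Sum>(c, U)\<leftarrow>xs. cscale c (U ** X ** cadj U)))"
    using assms
  proof (induction rule: conj_span.induct)
    case (conj U)
    then show ?case
      by (intro exI[of _ "[(1, U)]"]) simp
  next
    case (add S T)
    then obtain xs ys where
      "\<forall>(c, U) \<in> set xs. cunitary U" "\<forall>X. S X = (\<Sum>(c, U)\<leftarrow>xs. cscale c (U ** X ** cadj U))"
      "\<forall>(c, U) \<in> set ys. cunitary U" "\<forall>X. T X = (\<Sum>(c, U)\<leftarrow>ys. cscale c (U ** X ** cadj U))"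
      by blast
    then show ?case
      by (intro exI[of _ "xs @ ys"]) auto
  next
    case (scale S d)
    then obtain xs where xs:
      "\<forall>(c, U) \<in> set xs. cunitary U" "\<forall>X. S X = (\<Sum>(c, U)\<leftarrow>xs. cscale c (U ** X ** cadj U))"
      by blast
    have "cscale d (\<Sum>(c, U)\<leftarrow>xs. cscale c (U ** X ** cadj U))
        = (\<Sum>(c, U)\<leftarrow>map (\<lambda>(c, U). (d * c, U)) xs. cscale c (U ** X ** cadj U))" for X
      by (induction xs) (auto simp: cscale_add_right)
    then show ?case
      using xs by (intro exI[of _ "map (\<lambda>(c, U). (d * c, U)) xs"]) auto
  qed
  then obtain xs where xs: "\<forall>(c, U) \<in> set xs. cunitary U"
      "\<And>X. T X = (\<Sum>(c, U)\<leftarrow>xs. cscale c (U ** X ** cadj U))"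
    by blast
  show ?thesis
  proof
    show "cunitary (snd (xs ! i))" if "i < length xs" for i
      using xs(1) nth_mem[OF that] by (auto simp: split_def)
    show "T X = (\<Sum>i<length xs. cscale (fst (xs ! i)) (snd (xs ! i) ** X ** cadj (snd (xs ! i))))" for X
      by (simp add: xs(2) sum_list_sum_nth split_def atLeast0LessThan)
  qed
qed

section \<open>Diagonal phases and projections to off-diagonal entries\<close>

definition diag_matrix :: "('n \<Rightarrow> complex) \<Rightarrow> complex^'n^'n" where
  "diag_matrix d = (\<chi> a b. if a = b then d a else 0)"

lemma diag_matrix_mult: "(diag_matrix d ** X) $ a $ b = d a * X $ a $ b"
  by (simp add: diag_matrix_def matrix_mult_nth if_distrib[of "\<lambda>z. z * _"] cong: if_cong)

lemma mult_diag_matrix: "(X ** diag_matrix d) $ a $ b = X $ a $ b * d b"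
  by (simp add: diag_matrix_def matrix_mult_nth if_distrib[of "\<lambda>z. _ * z"] cong: if_cong)

lemma cadj_diag_matrix: "cadj (diag_matrix d) = diag_matrix (\<lambda>a. cnj (d a))"
  by (simp add: vec_eq_iff diag_matrix_def)

lemma cunitary_diag_matrix: "(\<And>a. d a * cnj (d a) = 1) \<Longrightarrow> cunitary (diag_matrix d)"
  unfolding cunitary_def cadj_diag_matrix vec_eq_iff diag_matrix_mult
  by (simp add: diag_matrix_def mat_def mult.commute)

definition phase :: "'n \<Rightarrow> complex \<Rightarrow> complex^'n^'n" where
  "phase i z = diag_matrix (\<lambda>a. if a = i then z else 1)"

lemma phase_conj_nth:
  "(phase i z ** X ** cadj (phase i z)) $ a $ b
     = (if a = i then z else 1) * X $ a $ b * cnj (if b = i then z else 1)"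
  by (simp add: phase_def diag_matrix_mult mult_diag_matrix cadj_diag_matrix)

text \<open>A discrete Fourier average over the fourth roots of unity. Conjugation by
  \<open>phase i z\<close> multiplies an entry by z in row i off the diagonal, by the conjugate of z
  in column i off the diagonal, and by 1 elsewhere. The weight \<open>f\<close> selects one of these
  powers of z.\<close>

definition phase_average :: "'n \<Rightarrow> (complex \<Rightarrow> complex) \<Rightarrow> complex^'n^'n \<Rightarrow> complex^'n^'n" where
  "phase_average i f X = (\<Sum>z\<in>{1, -1, \<i>, -\<i>}. cscale (f z / 4) (phase i z ** X ** cadj (phase i z)))"

lemma conj_span_phase_average: "conj_span (phase_average i f)"
proof -
  have "conj_span (\<lambda>X. phase_average i f X)"
    unfolding phase_average_def
    by (intro conj_span_sum conj_span.scale conj_span.conj) (auto simp: phase_def intro!: cunitary_diag_matrix)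
  then show ?thesis by simp
qed

lemma phase_average_cnj_nth:
  "phase_average i cnj X $ a $ b = (if a = i \<and> b \<noteq> i then X $ a $ b else 0)"
  by (simp add: phase_average_def phase_conj_nth complex_eq_iff)

lemma phase_average_id_nth:
  "phase_average j (\<lambda>z. z) X $ a $ b = (if a \<noteq> j \<and> b = j then X $ a $ b else 0)"
  by (simp add: phase_average_def phase_conj_nth complex_eq_iff)

text \<open>Projecting to column j and then to row i, both without their diagonal entry, leaves only
  the entry (i, j).\<close>

lemma conj_span_off_diagonal_entry:
  assumes "i \<noteq> j"
  shows "conj_span (\<lambda>X. cscale (hs_inner (matrix_unit i j) X) (matrix_unit i j))"
proof -
  have "phase_average i cnj (phase_average j (\<lambda>z. z) X) = cscale (hs_inner (matrix_unit i j) X) (matrix_unit i j)" for X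
    using assms by (auto simp: vec_eq_iff phase_average_cnj_nth phase_average_id_nth hs_inner_matrix_unit matrix_unit_nth)
  then show ?thesis
    using conj_span_comp[OF conj_span_phase_average conj_span_phase_average, of i cnj j "\<lambda>z. z"] by simp
qed

section \<open>Unitary conjugates of a matrix unit span the traceless matrices\<close>

definition swap_matrix :: "'n \<Rightarrow> 'n \<Rightarrow> complex^'n^'n" where
  "swap_matrix k l = (\<chi> a b. if a = Transposition.transpose k l b then 1 else 0)"

lemma transpose_eq_swap: "a = Transposition.transpose k l b \<longleftrightarrow> b = Transposition.transpose k l a"
  by (metis transpose_involutory)

lemma mult_swap_matrix: "(X ** swap_matrix k l) $ a $ b = X $ a $ Transposition.transpose k l b"
  by (simp add: swap_matrix_def matrix_mult_nth if_distrib[of "\<lambda>z. _ * z"] cong: if_cong)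

lemma swap_matrix_mult: "(swap_matrix k l ** X) $ a $ b = X $ Transposition.transpose k l a $ b"
  by (simp add: swap_matrix_def matrix_mult_nth transpose_eq_swap[of a] if_distrib[of "\<lambda>z. z * _"] cong: if_cong)

lemma cadj_swap_matrix: "cadj (swap_matrix k l) = swap_matrix k l"
  by (auto simp: vec_eq_iff swap_matrix_def)

lemma cunitary_swap_matrix: "cunitary (swap_matrix k l)"
  unfolding cunitary_def cadj_swap_matrix vec_eq_iff swap_matrix_mult
  by (simp add: swap_matrix_def mat_def) (metis transpose_involutory)

lemma swap_conj_matrix_unit:
  "swap_matrix k l ** matrix_unit i j ** cadj (swap_matrix k l)
     = matrix_unit (Transposition.transpose k l i) (Transposition.transpose k l j)"
  unfolding cadj_swap_matrix vec_eq_iff mult_swap_matrix swap_matrix_mult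
  by (auto simp: matrix_unit_nth)

lemma matrix_unit_mult: "matrix_unit i j ** matrix_unit k l = (if j = k then matrix_unit i l else 0)"
  by (auto simp: vec_eq_iff matrix_mult_nth matrix_unit_nth if_distrib[of "\<lambda>z. z * _"] cong: if_cong)

text \<open>The reflection with block ((3, 4), (4, -3)) / 5 in the rows and columns i, j: it is rational,
  and it conjugates E_ij to a matrix with nonzero diagonal.\<close>
definition reflection :: "'n \<Rightarrow> 'n \<Rightarrow> complex^'n^'n" where
  "reflection i j = mat 1 + cscale (-2/5) (matrix_unit i i) + cscale (4/5) (matrix_unit i j)
     + cscale (4/5) (matrix_unit j i) + cscale (-8/5) (matrix_unit j j)"

lemma cadj_reflection: "cadj (reflection i j) = reflection i j"
  by (simp add: vec_eq_iff reflection_def matrix_unit_nth mat_def)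

lemma cunitary_reflection:
  assumes "i \<noteq> j"
  shows "cunitary (reflection i j)"
proof -
  have "reflection i j ** reflection i j = mat 1"
    using assms
    unfolding reflection_def matrix_add_ldistrib matrix_mult_add_left matrix_mult_cscale_left
      matrix_mult_cscale_right matrix_unit_mult matrix_mul_lid matrix_mul_rid
    by (auto simp: vec_eq_iff matrix_unit_nth)
  then show ?thesis
    by (simp add: cunitary_def cadj_reflection)
qed

text \<open>The conjugate of E_ij is (3 e_i + 4 e_j)(4 e_i - 3 e_j)^T / 25, with diagonal part 12/25
  (E_ii - E_jj); the factor 25/12 normalises this and the other two terms remove the off-diagonal
  part.\<close>

lemma reflection_conj_matrix_unit:
  assumes "i \<noteq> j"
  shows "matrix_unit i i + cscale (-1) (matrix_unit j j)
    = cscale (25/12) (reflection i j ** matrix_unit i j ** cadj (reflection i j))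
      + cscale (3/4) (matrix_unit i j) + cscale (-4/3) (matrix_unit j i)"
proof -
  have left: "reflection i j ** matrix_unit i j = cscale (3/5) (matrix_unit i j) + cscale (4/5) (matrix_unit j j)"
    using assms
    by (simp add: reflection_def matrix_mult_add_left matrix_mult_cscale_left matrix_unit_mult)
      (simp add: vec_eq_iff)
  have right: "matrix_unit a j ** reflection i j = cscale (4/5) (matrix_unit a i) + cscale (-3/5) (matrix_unit a j)" for a
    using assms
    by (simp add: reflection_def matrix_add_ldistrib matrix_mult_cscale_right matrix_unit_mult)
      (simp add: vec_eq_iff)
  show ?thesis
    by (simp add: cadj_reflection left right matrix_mult_add_left matrix_mult_cscale_left cscale_add_right)
      (simp add: vec_eq_iff)
qed

text \<open>The corrections add up to - tr(A) E_ee = 0. They turn the diagonal units into the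
  traceless differences E_ii - E_ee.\<close>

lemma traceless_expansion:
  assumes "trace A = 0"
  shows "A = (\<Sum>i\<in>UNIV. \<Sum>j\<in>UNIV. cscale (A $ i $ j)
    (matrix_unit i j + cscale (if i = j then -1 else 0) (matrix_unit e e)))"
proof -
  have "(\<Sum>i\<in>UNIV. \<Sum>j\<in>UNIV. cscale (A $ i $ j) (cscale (if i = j then -1 else 0) (matrix_unit e e)))
      = cscale (- trace A) (matrix_unit e e)"
    by (auto simp: vec_eq_iff trace_def matrix_unit_nth if_distrib[of "(*) _"] sum_negf cong: if_cong)
  then show ?thesis
    using assms matrix_unit_expansion[of A] by (simp add: cscale_add_right sum.distrib)
qed

text \<open>Permutations carry one off-diagonal unit to all others, reflections produce the
  differences E_kk - E_ll from these, and together they span the traceless matrices.\<close>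

lemma traceless_induct:
  assumes tr: "trace A = 0" and "i \<noteq> j" and unit: "P (matrix_unit i j)"
    and add: "\<And>A B. P A \<Longrightarrow> P B \<Longrightarrow> P (A + B)"
    and scale: "\<And>c A. P A \<Longrightarrow> P (cscale c A)"
    and conj: "\<And>U A. cunitary U \<Longrightarrow> P A \<Longrightarrow> P (U ** A ** cadj U)"
  shows "P A"
proof -
  have units: "P (matrix_unit k l)" if "k \<noteq> l" for k l
  proof -
    \<comment> \<open>A first swap brings i to k and j to j'. The second swap takes j' to l and
      fixes k, which differs from both.\<close>
    define j' where "j' = Transposition.transpose i k j"
    have "P (matrix_unit k j')"
      using conj[OF cunitary_swap_matrix[of i k] unit] by (simp add: swap_conj_matrix_unit j'_def)
    moreover have "j' \<noteq> k"
      using \<open>i \<noteq> j\<close> by (metis j'_def transpose_apply_first transpose_involutory)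
    ultimately show ?thesis
      using conj[OF cunitary_swap_matrix[of j' l], of "matrix_unit k j'"] that
      by (simp add: swap_conj_matrix_unit transpose_apply_other)
  qed
  have diag: "P (matrix_unit k k + cscale (-1) (matrix_unit l l))" if "k \<noteq> l" for k l
    unfolding reflection_conj_matrix_unit[OF that]
    using that by (intro add scale conj units cunitary_reflection) auto
  have zero: "P 0"
    using scale[OF unit, of 0] by simp
  have sum: "P (\<Sum>i\<in>I. F i)" if "\<And>i. P (F i)" for F and I :: "'a set"
    by (induction I rule: infinite_finite_induct) (auto simp: zero that intro: add)
  have "P (matrix_unit k l + cscale (if k = l then -1 else 0) (matrix_unit i i))" for k l
  proof (cases "k = l")
    case True
    have "matrix_unit i i + cscale (-1) (matrix_unit i i) = 0"
      by (simp add: vec_eq_iff)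
    then show ?thesis
      using True zero diag by (cases "k = i") auto
  qed (simp add: units)
  then show ?thesis
    by (subst traceless_expansion[OF tr, of i]) (intro sum scale)
qed

lemma hs_inner_add_left: "hs_inner (A + B) X = hs_inner A X + hs_inner B X"
  by (simp add: hs_inner_eq_sum distrib_right sum.distrib)

lemma hs_inner_cscale_left: "hs_inner (cscale c A) X = cnj c * hs_inner A X"
  by (simp add: hs_inner_eq_sum sum_distrib_left mult_ac)

text \<open>Two inductions start from |E_ij><E_ij|: conjugations applied after the map change A,
  conjugations applied before it change B. The map depends antilinearly on B, whence the conjugated
  scalar in the second induction.\<close>

lemma conj_span_traceless_rank_one:
  fixes A B :: "complex^'n^'n"
  assumes "trace A = 0" "trace B = 0" "i \<noteq> (j::'n)"
  shows "conj_span (\<lambda>X. cscale (hs_inner B X) A)"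
proof -
  let ?E = "matrix_unit i j"
  have E: "conj_span (\<lambda>X. cscale (hs_inner ?E X) A)"
  proof (rule traceless_induct[where P = "\<lambda>A. conj_span (\<lambda>X. cscale (hs_inner ?E X) A)", OF assms(1,3)])
    show "conj_span (\<lambda>X. cscale (hs_inner ?E X) (C + D))"
      if "conj_span (\<lambda>X. cscale (hs_inner ?E X) C)" "conj_span (\<lambda>X. cscale (hs_inner ?E X) D)" for C D
      using conj_span.add[OF that] by (simp add: cscale_add_right)
    show "conj_span (\<lambda>X. cscale (hs_inner ?E X) (cscale c C))"
      if "conj_span (\<lambda>X. cscale (hs_inner ?E X) C)" for c C
      using conj_span.scale[OF that, of c] by (simp add: mult.commute)
    show "conj_span (\<lambda>X. cscale (hs_inner ?E X) (U ** C ** cadj U))"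
      if "cunitary U" "conj_span (\<lambda>X. cscale (hs_inner ?E X) C)" for U C
      using conj_span_comp[OF conj_span.conj[OF that(1)] that(2)]
      by (simp add: matrix_mult_cscale_left matrix_mult_cscale_right)
  qed (rule conj_span_off_diagonal_entry[OF assms(3)])
  show ?thesis
  proof (rule traceless_induct[where P = "\<lambda>B. conj_span (\<lambda>X. cscale (hs_inner B X) A)", OF assms(2,3)])
    show "conj_span (\<lambda>X. cscale (hs_inner (C + D) X) A)"
      if "conj_span (\<lambda>X. cscale (hs_inner C X) A)" "conj_span (\<lambda>X. cscale (hs_inner D X) A)" for C D
      using conj_span.add[OF that] by (simp add: cscale_add_left hs_inner_add_left)
    show "conj_span (\<lambda>X. cscale (hs_inner (cscale c C) X) A)"
      if "conj_span (\<lambda>X. cscale (hs_inner C X) A)" for c C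
      using conj_span.scale[OF that, of "cnj c"] by (simp add: hs_inner_cscale_left)
    show "conj_span (\<lambda>X. cscale (hs_inner (U ** C ** cadj U) X) A)"
      if "cunitary U" "conj_span (\<lambda>X. cscale (hs_inner C X) A)" for U C
      using conj_span_comp[OF that(2) conj_span.conj[OF cunitary_cadj[OF that(1)]]]
      by (simp add: hs_inner_conjugate)
  qed (rule E)
qed

section \<open>Unital trace-preserving maps as affine combinations\<close>

lemma matrix_unit_diagonal_sum: "(\<Sum>a\<in>UNIV. matrix_unit i j $ a $ a) = (if i = j then 1 else 0)"
  by (cases "i = j") (auto simp: matrix_unit_nth intro!: sum.neutral)

text \<open>The difference R = T - id has traceless values and vanishes at 1. It is therefore a sum
  of operators |A><B| with A and B traceless, and adding the identity recovers T.\<close>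

lemma conj_span_unital_trace_preserving:
  fixes T :: "complex^'n^'n \<Rightarrow> complex^'n^'n"
  assumes lin: "clinear_map T" and tp: "trace_preserving T" and unital: "unital T"
  shows "conj_span T"
proof -
  define e :: 'n where "e = undefined"
  define R where "R X = T X + cscale (-1) X" for X
  \<comment> \<open>Pairing X with \<open>B i j\<close> reads the entry (i, j) of X - X_ee 1, where
    e is an arbitrary fixed index.\<close>
  define B where "B i j = matrix_unit i j + cscale (if i = j then -1 else 0) (matrix_unit e e)" for i j
  have Rlin: "clinear_map R"
    using lin by (simp add: R_def clinear_map_def cscale_add_right mult_ac)
  have trR: "trace (R X) = 0" for X
    using tp by (simp add: R_def trace_preserving_def trace_def sum_subtractf)
  have trB: "trace (B i j) = 0" for i j
    by (simp add: B_def trace_def matrix_unit_diagonal_sum sum.distrib sum_negf)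
  have "R (mat 1) = 0"
    using unital by (simp add: R_def unital_def vec_eq_iff)
  have R: "R X = (\<Sum>i\<in>UNIV. \<Sum>j\<in>UNIV. cscale (hs_inner (B i j) X) (R (matrix_unit i j)))" for X
  proof -
    \<comment> \<open>Since R vanishes at 1, this shift does not change the value of R, and the
      entries of Y are the pairings with the traceless \<open>B i j\<close>.\<close>
    define Y where "Y = X + cscale (- X $ e $ e) (mat 1)"
    have "R X = R Y"
      using Rlin \<open>R (mat 1) = 0\<close> by (simp add: Y_def clinear_map_add clinear_map_cscale)
    also have "\<dots> = (\<Sum>i\<in>UNIV. \<Sum>j\<in>UNIV. cscale (Y $ i $ j) (R (matrix_unit i j)))"
      using Rlin by (subst matrix_unit_expansion[of Y]) (simp add: clinear_map_sum clinear_map_cscale)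
    also have "\<dots> = (\<Sum>i\<in>UNIV. \<Sum>j\<in>UNIV. cscale (hs_inner (B i j) X) (R (matrix_unit i j)))"
      by (intro sum.cong refl)
        (simp add: Y_def B_def hs_inner_add_left hs_inner_cscale_left hs_inner_matrix_unit mat_def)
    finally show ?thesis .
  qed
  have "conj_span (\<lambda>X. cscale (hs_inner (B i j) X) (R (matrix_unit i j)))" for i j
  proof (cases "\<exists>k l :: 'n. k \<noteq> l")
    case True
    then show ?thesis
      using conj_span_traceless_rank_one[OF trR trB] by blast
  next
    \<comment> \<open>In dimension one there is no off-diagonal unit, but the only
      \<open>B i j\<close> is then 0.\<close>
    case False
    then have "i = e" "j = e"
      by auto
    then have "B i j = 0"
      by (simp add: B_def vec_eq_iff)
    then show ?thesis
      using conj_span_zero by (simp add: hs_inner_eq_sum)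
  qed
  then have "conj_span (\<lambda>X. (\<Sum>i\<in>UNIV. \<Sum>j\<in>UNIV. cscale (hs_inner (B i j) X) (R (matrix_unit i j))) + X)"
    by (intro conj_span.add conj_span_sum conj_span_id)
  then have "conj_span (\<lambda>X. R X + X)"
    unfolding R[symmetric] .
  moreover have "R X + X = T X" for X
    by (simp add: R_def vec_eq_iff)
  ultimately show ?thesis
    by simp
qed

text \<open>Averaging a complex combination with its Hermitian conjugate replaces the coefficients by their real parts.\<close>
lemma unital_channel_affine_combination:
  fixes T :: "complex^'n^'n \<Rightarrow> complex^'n^'n"
  assumes T: "quantum_channel T" and unital: "unital T"
  obtains m :: nat and lam :: "nat \<Rightarrow> real" and U where
    "\<And>i. i < m \<Longrightarrow> cunitary (U i)" "(\<Sum>i<m. lam i) = 1"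
    "\<And>X. T X = (\<Sum>i<m. cscale (complex_of_real (lam i)) (U i ** X ** cadj (U i)))"
proof -
  obtain m c U where U: "\<And>i. i < (m::nat) \<Longrightarrow> cunitary (U i)"
    and c: "\<And>X. T X = (\<Sum>i<m. cscale (c i) (U i ** X ** cadj (U i)))"
  proof (rule conj_span_finite_combination)
    show "conj_span T"
      using T unital by (simp add: quantum_channel_def conj_span_unital_trace_preserving)
  qed blast
  \<comment> \<open>Taking adjoints of input and output fixes T and each unitary conjugation, and
    conjugates the coefficients.\<close>
  have herm: "T X = (\<Sum>i<m. cscale (cnj (c i)) (U i ** X ** cadj (U i)))" for X
  proof -
    have "T X = cadj (T (cadj X))"
      using T unital by (simp add: unital_cp_hermitian_preserving quantum_channel_def)
    also have "\<dots> = (\<Sum>i<m. cadj (cscale (c i) (U i ** cadj X ** cadj (U i))))"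
      unfolding c by (simp add: vec_eq_iff)
    also have "\<dots> = (\<Sum>i<m. cscale (cnj (c i)) (U i ** X ** cadj (U i)))"
    proof -
      have "cadj (cscale d A) = cscale (cnj d) (cadj A)" for d and A :: "complex^'n^'n"
        by (simp add: vec_eq_iff)
      then show ?thesis
        by (simp add: cadj_mult matrix_mul_assoc)
    qed
    finally show ?thesis .
  qed
  have real: "T X = (\<Sum>i<m. cscale (complex_of_real (Re (c i))) (U i ** X ** cadj (U i)))" for X
  proof -
    have "cscale 2 (T X) = T X + T X"
      by (simp add: vec_eq_iff)
    also have "\<dots> = (\<Sum>i<m. cscale (c i + cnj (c i)) (U i ** X ** cadj (U i)))"
      by (subst (2) herm, subst c) (simp add: cscale_add_left sum.distrib)
    also have "\<dots> = cscale 2 (\<Sum>i<m. cscale (complex_of_real (Re (c i))) (U i ** X ** cadj (U i)))"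
      by (simp add: complex_add_cnj vec_eq_iff sum_distrib_left mult.assoc)
    finally show ?thesis
      by (simp add: vec_eq_iff)
  qed
  have "mat 1 = (\<Sum>i<m. cscale (complex_of_real (Re (c i))) (mat 1 :: complex^'n^'n))"
    using real[of "mat 1"] unital U by (simp add: unital_def cunitary_def)
  \<comment> \<open>Each conjugation fixes 1, so any single diagonal entry, here at the index
    \<open>undefined\<close>, gives the sum of the coefficients.\<close>
  then have "(mat 1 :: complex^'n^'n) $ undefined $ undefined
      = (\<Sum>i<m. cscale (complex_of_real (Re (c i))) (mat 1 :: complex^'n^'n)) $ undefined $ undefined"
    by simp
  then have "(\<Sum>i<m. Re (c i)) = 1"
    by (simp add: mat_def flip: of_real_sum)
  with U real show ?thesis
    by (intro that)
qed

lemma unital_if_affine_combination: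
  fixes T :: "complex^'n^'n \<Rightarrow> complex^'n^'n" and lam :: "nat \<Rightarrow> real"
  assumes "\<And>i. i < m \<Longrightarrow> cunitary (U i)" "(\<Sum>i<m. lam i) = 1"
    and T: "\<And>X. T X = (\<Sum>i<m. cscale (complex_of_real (lam i)) (U i ** X ** cadj (U i)))"
  shows "unital T"
proof -
  have "T (mat 1) = (\<Sum>i<m. lam i *\<^sub>R mat 1)"
    using assms(1) by (simp add: T cunitary_def scaleR_eq_cscale)
  then show ?thesis
    using assms(2) by (simp add: unital_def flip: scaleR_sum_left)
qed

section \<open>The two equivalences\<close>

theorem theorem1:
  fixes T :: "complex^'n::finite^'n \<Rightarrow> complex^'n^'n"
  assumes "quantum_channel T"
  shows "(unital T \<longleftrightarrow>
           (\<exists>(m::nat) (p::nat \<Rightarrow> real) W. (\<forall>i<m. p i \<ge> 0 \<and> hs_unitary (W i)) \<and> (\<Sum>i<m. p i) = 1 \<and>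
              (\<forall>A. T A = (\<Sum>i<m. cscale (complex_of_real (p i)) (W i A)))))
       \<and> (unital T \<longleftrightarrow>
           (\<exists>(m::nat) (lam::nat \<Rightarrow> real) U. (\<forall>i<m. cunitary (U i)) \<and> (\<Sum>i<m. lam i) = 1 \<and>
              (\<forall>\<rho>. T \<rho> = (\<Sum>i<m. cscale (complex_of_real (lam i)) (U i ** \<rho> ** cadj (U i))))))"
    (is "(_ \<longleftrightarrow> ?convex) \<and> (_ \<longleftrightarrow> ?affine)")
proof (intro conjI iffI)
  have lin: "clinear_map T" and tp: "trace_preserving T"
    using assms by (auto simp: quantum_channel_def)
  show ?convex if "unital T"
    using hs_contraction_convex_combination[OF lin unital_channel_contraction[OF assms that]] by metis
  show "unital T" if convex: ?convex
  proof -
    obtain m :: nat and p W where "\<forall>i<m. 0 \<le> p i \<and> hs_unitary (W i)" "(\<Sum>i<m. p i) = 1"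
      "\<forall>A. T A = (\<Sum>i<m. cscale (complex_of_real (p i)) (W i A))"
      using convex by blast
    then show ?thesis
      by (intro unital_if_convex_combination[OF tp, of m p W]) auto
  qed
  show ?affine if "unital T"
    by (rule unital_channel_affine_combination[OF assms that]) blast
  show "unital T" if affine: ?affine
  proof -
    obtain m :: nat and lam U where "\<forall>i<m. cunitary (U i)" "(\<Sum>i<m. lam i) = 1"
      "\<forall>X. T X = (\<Sum>i<m. cscale (complex_of_real (lam i)) (U i ** X ** cadj (U i)))"
      using affine by blast
    then show ?thesis
      by (intro unital_if_affine_combination[of m U lam T]) auto
  qed
qed

end
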